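(* Let $\mathcal Q:\mathcal S\to M(n\times n,\mathbb R)$ be a smooth mapping sending each $K$ to a symmetric matrix $\mathcal Q_K\succ0$. For any point $K\in\mathcal S$ and any direction $G\in T_K\mathcal S\cong M(m\times n,\mathbb R)$, if $$0\le\eta\le s_K:=\frac{\underline\lambda(\mathcal Q_K)}{2\,\overline\lambda\big(\mathbb L(A_{\mathrm{cl}}^\top,\mathcal Q_K)\big)\,\|BG\|_2},$$ where $A_{\mathrm{cl}}=A+BK$, then $K^+:=K+\eta G\in\mathcal S$.
   Context: $M(p\times q,\mathbb R)$ is the space of real $p\times q$ matrices; $\rho$ is the spectral radius; $\|\cdot\|_2$ the spectral norm; $\overline\lambda$ and $\underline\lambda$ the maximum and minimum eigenvalues of a symmetric matrix. $(A,B)$ is a stabilizable pair with $A\in M(n\times n,\mathbb R)$, $B\in M(n\times m,\mathbb R)$, and $\mathcal S=\{K\in M(m\times n,\mathbb R):\rho(A+BK)<1\}$, an open subset of $M(m\times n,\mathbb R)$. For $\rho(M)<1$, $\mathbb L(M,Z)$ denotes the unique solution $X$ of $X=MXM^\top+Z$. The quantity $s_K$ is called the stability certificate at $K$; when $BG=0$ it is read as $+\infty$. *)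

theory Defs
  imports "HOL-Analysis.Analysis"
begin

definition eigenvals :: "'a::field^'n^'n \<Rightarrow> 'a set" where
  "eigenvals M = {c. \<exists>v. v \<noteq> 0 \<and> M *v v = c *s v}"

definition spectral_rad :: "real^'n^'n \<Rightarrow> real" where
  "spectral_rad M = Max (norm ` eigenvals (map_matrix complex_of_real M))"

text \<open>The type-class norm on matrices is the Frobenius norm; the spectral norm is the
  operator norm induced by the Euclidean norms.\<close>

definition spectral_norm :: "real^'n^'m \<Rightarrow> real" where
  "spectral_norm M = onorm (\<lambda>v. M *v v)"

definition symmetric_matrix :: "real^'n^'n \<Rightarrow> bool" where
  "symmetric_matrix M \<longleftrightarrow> transpose M = M"

definition positive_definite :: "real^'n^'n \<Rightarrow> bool" where
  "positive_definite M \<longleftrightarrow> (\<forall>v. v \<noteq> 0 \<longrightarrow> v \<bullet> (M *v v) > 0)"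

text \<open>The following two are used for symmetric matrices only, whose eigenvalues are all real.\<close>

definition max_eigenval :: "real^'n^'n \<Rightarrow> real" where
  "max_eigenval M = Max (eigenvals M)"

definition min_eigenval :: "real^'n^'n \<Rightarrow> real" where
  "min_eigenval M = Min (eigenvals M)"

text \<open>\<open>C_k_on k f S\<close>: \<open>f\<close> is of class $C^k$ on the open set \<open>S\<close>. Since the domain is
  finite-dimensional, it is enough that each directional derivative is of class $C^{k-1}$.\<close>

fun C_k_on :: "nat \<Rightarrow> ('a::euclidean_space \<Rightarrow> 'b::euclidean_space) \<Rightarrow> 'a set \<Rightarrow> bool" where
  "C_k_on 0 f S \<longleftrightarrow> continuous_on S f"
| "C_k_on (Suc k) f S \<longleftrightarrow> (\<forall>x\<in>S. f differentiable (at x)) \<and>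
     (\<forall>v. C_k_on k (\<lambda>x. frechet_derivative f (at x) v) S)"

definition smooth_map_on :: "'a::euclidean_space set \<Rightarrow> ('a \<Rightarrow> 'b::euclidean_space) \<Rightarrow> bool" where
  "smooth_map_on S f \<longleftrightarrow> (\<forall>k. C_k_on k f S)"

definition stabilizing_gains :: "real^'n^'n \<Rightarrow> real^'m^'n \<Rightarrow> (real^'n^'m) set" where
  "stabilizing_gains A B = {K. spectral_rad (A + B ** K) < 1}"

definition stabilizable :: "real^'n^'n \<Rightarrow> real^'m^'n \<Rightarrow> bool" where
  "stabilizable A B \<longleftrightarrow> (\<exists>K. spectral_rad (A + B ** K) < 1)"

text \<open>Meaningful for \<open>spectral_rad M < 1\<close>, when the discrete Lyapunov equation has exactly one
  solution.\<close>

definition lyapunov_sol :: "real^'n^'n \<Rightarrow> real^'n^'n \<Rightarrow> real^'n^'n" where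
  "lyapunov_sol M Z = (THE X. X = M ** X ** transpose M + Z)"

definition stability_certificate ::
    "real^'n^'n \<Rightarrow> real^'m^'n \<Rightarrow> (real^'n^'m \<Rightarrow> real^'n^'n) \<Rightarrow> real^'n^'m \<Rightarrow> real^'n^'m \<Rightarrow> ereal" where
  "stability_certificate A B Q K G =
     (if B ** G = 0 then \<infinity>
      else ereal (min_eigenval (Q K) /
        (2 * max_eigenval (lyapunov_sol (transpose (A + B ** K)) (Q K)) * spectral_norm (B ** G))))"

end

(* In the norm |v|_X = sqrt (v . X v) given by the Lyapunov solution X = A^T X A + Q, the closed loop
   A = A_cl is a strict contraction, and the bound on eta is just small enough for A + eta B G
   still to be one; this forces every complex eigenvalue into the open unit disc.
   Solvability of the Lyapunov equation and X >= Q come from A^k v --> 0.  For that limit, an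
   annihilating polynomial of v is split into linear factors, each of which can be cancelled: c
   with |c| < 1 by a perturbed geometric recursion, any other c because it is no eigenvalue. *)

theory Submission
  imports Defs "HOL-Computational_Algebra.Fundamental_Theorem_Algebra"
begin

section \<open>Polynomials in a matrix, annihilating polynomials and the spectrum\<close>

text \<open>The vector p(M) v by Horner's scheme, so that polynomial induction over
  \<open>pCons\<close> applies directly.\<close>

definition matrix_poly :: "'a::field^'n^'n \<Rightarrow> 'a poly \<Rightarrow> 'a^'n \<Rightarrow> 'a^'n" where
  "matrix_poly M p v = fold_coeffs (\<lambda>a w. a *s v + M *v w) p 0"

lemma matrix_poly_0 [simp]: "matrix_poly M 0 v = 0"
  by (simp add: matrix_poly_def)

lemma matrix_poly_pCons [simp]: "matrix_poly M (pCons a p) v = a *s v + M *v matrix_poly M p v"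
  by (cases "p = 0 \<and> a = 0") (auto simp: matrix_poly_def)

lemma matrix_poly_add: "matrix_poly M (p + q) v = matrix_poly M p v + matrix_poly M q v"
  by (induction p q rule: poly_induct2)
     (simp_all add: vec.scale_left_distrib matrix_vector_right_distrib)

lemma matrix_poly_smult: "matrix_poly M (smult c p) v = c *s matrix_poly M p v"
  by (induction p) (simp_all add: vec.scale_right_distrib vec.scale)

lemma matrix_poly_diff: "matrix_poly M (p - q) v = matrix_poly M p v - matrix_poly M q v"
  using matrix_poly_add[of M "p - q" q v] by (simp add: algebra_simps)

lemma matrix_poly_sum: "matrix_poly M (sum f S) v = (\<Sum>i\<in>S. matrix_poly M (f i) v)"
  by (induction S rule: infinite_finite_induct) (simp_all add: matrix_poly_add)

lemma matrix_poly_monom: "matrix_poly M (monom c n) v = c *s (((*v) M ^^ n) v)"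
  by (induction n) (simp_all add: monom_Suc monom_0 vec.scale)

lemma matrix_poly_mult: "matrix_poly M (p * q) v = matrix_poly M p (matrix_poly M q v)"
  by (induction p) (simp_all add: matrix_poly_add matrix_poly_smult)

lemma matrix_poly_zero_right [simp]: "matrix_poly M p 0 = 0"
  by (induction p) simp_all

lemma matrix_poly_vec_add:
  "matrix_poly M p (v + w) = matrix_poly M p v + matrix_poly M p w"
  by (induction p) (simp_all add: vec.scale_right_distrib matrix_vector_right_distrib)

lemma matrix_poly_vec_scale: "matrix_poly M p (c *s v) = c *s matrix_poly M p v"
  by (induction p) (simp_all add: vec.scale_right_distrib vec.scale vec.scale_left_commute)

lemma matrix_poly_eigenvector:
  assumes "M *v v = c *s v"
  shows "matrix_poly M p v = poly p c *s v"
  by (induction p) (simp_all add: assms vec.scale vec.scale_left_distrib mult.commute)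

text \<open>The CARD('n) + 1 vectors v, M v, M^2 v, ... are linearly dependent, and the coefficients
  of a dependence are those of the polynomial.\<close>

lemma ex_annihilating_poly_vec:
  fixes M :: "'a::field^'n^'n"
  shows "\<exists>p. p \<noteq> 0 \<and> matrix_poly M p v = 0"
proof -
  let ?n = "CARD('n)"
  let ?f = "\<lambda>i. ((*v) M ^^ i) v"
  show ?thesis
  \<comment> \<open>Dependence is a property of the set of vectors, so coinciding powers need their
    own polynomial.\<close>
  proof (cases "inj_on ?f {..?n}")
    case True
    have "vec.dependent (?f ` {..?n})"
    proof (rule ccontr)
      assume "vec.independent (?f ` {..?n})"
      then have "card (?f ` {..?n}) \<le> vec.dim (UNIV :: ('a^'n) set)"
        using vec.independent_card_le_dim by blast
      then show False
        using True by (simp add: card_image vec.dim_UNIV card_cart_basis)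
    qed
    then obtain u k where k: "k \<le> ?n" "u (?f k) \<noteq> 0"
      and sum: "(\<Sum>w\<in>?f ` {..?n}. u w *s w) = 0"
      by (subst (asm) vec.dependent_finite) auto
    define p where "p = (\<Sum>i\<le>?n. monom (u (?f i)) i)"
    have "coeff p k = u (?f k)"
      using k by (simp add: p_def coeff_sum)
    then have "p \<noteq> 0" using k(2) by (metis coeff_0)
    moreover have "matrix_poly M p v = 0"
      using sum True by (simp add: p_def matrix_poly_sum matrix_poly_monom sum.reindex)
    ultimately show ?thesis by blast
  next
    case False
    then obtain i j where ij: "i \<noteq> j" "?f i = ?f j" by (auto simp: inj_on_def)
    have "coeff (monom 1 i - monom 1 j :: 'a poly) i = 1"
      using ij by simp
    then have "monom 1 i - monom 1 j \<noteq> (0 :: 'a poly)" by (metis coeff_0 zero_neq_one)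
    moreover have "matrix_poly M (monom 1 i - monom 1 j) v = 0"
      using ij by (simp add: matrix_poly_diff matrix_poly_monom)
    ultimately show ?thesis by blast
  qed
qed

text \<open>The product of annihilating polynomials for the basis vectors kills the whole space by
  linearity.\<close>

lemma ex_annihilating_poly:
  fixes M :: "'a::field^'n^'n"
  shows "\<exists>p. p \<noteq> 0 \<and> (\<forall>v. matrix_poly M p v = 0)"
proof -
  have "\<exists>p. p \<noteq> 0 \<and> (\<forall>v\<in>S. matrix_poly M p v = 0)" if "finite S" for S
    using that
  proof (induction S)
    case empty
    show ?case by (rule exI[of _ 1]) simp
  next
    case (insert w S)
    then obtain p where p: "p \<noteq> 0" "\<forall>v\<in>S. matrix_poly M p v = 0" by blast
    obtain q where q: "q \<noteq> 0" "matrix_poly M q w = 0"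
      using ex_annihilating_poly_vec by blast
    have "matrix_poly M (p * q) v = 0" if "v \<in> insert w S" for v
    proof (cases "v = w")
      case True
      then show ?thesis by (simp add: matrix_poly_mult q)
    next
      case False
      \<comment> \<open>Polynomials in \<open>M\<close> commute, so \<open>p\<close> may be applied
        to \<open>v\<close> first.\<close>
      then show ?thesis
        using that p by (simp add: matrix_poly_mult mult.commute[of p q])
    qed
    then show ?case using p q by (intro exI[of _ "p * q"]) simp
  qed
  then obtain p where p: "p \<noteq> 0" "\<forall>v\<in>cart_basis. matrix_poly M p v = 0"
    using finite_cart_basis by blast
  have "matrix_poly M p v = 0" for v
  proof -
    have "v \<in> vec.span cart_basis" by (simp add: span_cart_basis)
    then show ?thesis
      by (induction rule: vec.span_induct_alt)
         (simp_all add: p matrix_poly_vec_add matrix_poly_vec_scale)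
  qed
  then show ?thesis using p by blast
qed

text \<open>Every eigenvalue is a root of an annihilating polynomial.\<close>

lemma finite_eigenvals: "finite (eigenvals M)"
proof -
  obtain p where p: "p \<noteq> 0" "\<And>v. matrix_poly M p v = 0"
    using ex_annihilating_poly by metis
  have "poly p c = 0" if "c \<in> eigenvals M" for c
  proof -
    obtain v where v: "v \<noteq> 0" "M *v v = c *s v" using \<open>c \<in> eigenvals M\<close> by (auto simp: eigenvals_def)
    have "poly p c *s v = 0" using matrix_poly_eigenvector[OF v(2)] p by metis
    then show ?thesis using v by (simp add: vec.scale_eq_0_iff)
  qed
  then have "eigenvals M \<subseteq> {c. poly p c = 0}" by blast
  then show ?thesis using poly_roots_finite[OF p(1)] finite_subset by blast
qed

text \<open>Induction on the degree: a root of \<open>p\<close> can be split off because \<open>P\<close> is stable under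
  cancelling one factor \<open>M - c\<close>.\<close>

lemma matrix_poly_cancel:
  fixes M :: "complex^'n^'n"
  assumes scale: "\<And>a v. a \<noteq> 0 \<Longrightarrow> P (a *s v) \<Longrightarrow> P v"
    and factor: "\<And>c v. P (M *v v - c *s v) \<Longrightarrow> P v"
    and "p \<noteq> 0" and "P (matrix_poly M p v)"
  shows "P v"
  using assms(3-)
proof (induction "degree p" arbitrary: p v rule: less_induct)
  case less
  show ?case
  proof (cases "degree p = 0")
    case True
    then obtain a where "p = [:a:]" by (meson degree_eq_zeroE)
    then show ?thesis using less.prems scale by simp
  next
    case False
    then obtain c where c: "poly p c = 0"
      using fundamental_theorem_of_algebra[of p] by (auto simp: constant_degree)
    then obtain q where q: "p = [:-c, 1:] * q" by (auto simp: poly_eq_0_iff_dvd)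
    then have "q \<noteq> 0" "degree q < degree p"
      using less.prems by (auto simp: degree_mult_eq simp del: mult_pCons_left)
    moreover have "P (matrix_poly M q v)"
    proof (rule factor)
      have "matrix_poly M p v = M *v matrix_poly M q v - c *s matrix_poly M q v"
        by (simp add: q matrix_poly_mult del: mult_pCons_left)
      then show "P (M *v matrix_poly M q v - c *s matrix_poly M q v)"
        using less.prems(2) by simp
    qed
    ultimately show ?thesis using less.hyps by blast
  qed
qed

text \<open>Without eigenvalues every factor M - c is injective, so all factors of an annihilating
  polynomial of the nonzero vector \<open>1\<close> could be cancelled.\<close>

lemma eigenvals_nonempty:
  fixes M :: "complex^'n^'n"
  shows "eigenvals M \<noteq> {}"
proof
  assume *: "eigenvals M = {}"
  obtain p where p: "p \<noteq> 0" "matrix_poly M p 1 = 0"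
    using ex_annihilating_poly_vec by blast
  have "(1 :: complex^'n) = 0"
  proof (rule matrix_poly_cancel[where P = "\<lambda>v. v = 0" and M = M and p = p])
    fix c and v :: "complex^'n"
    assume "M *v v - c *s v = 0"
    then show "v = 0" using * by (auto simp: eigenvals_def)
  qed (use p in \<open>auto simp: vec.scale_eq_0_iff\<close>)
  then show False by simp
qed

text \<open>The \<open>Max\<close> ranges over a finite nonempty set, hence is a genuine
  maximum.\<close>

lemma spectral_rad_less_iff:
  "spectral_rad M < r \<longleftrightarrow> (\<forall>c\<in>eigenvals (map_matrix complex_of_real M). norm c < r)"
  by (simp add: spectral_rad_def finite_eigenvals eigenvals_nonempty)

section \<open>Powers of a stable matrix tend to zero\<close>

lemma norm_vector_scalar_mult:
  fixes v :: "'a::real_normed_field^'n"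
  shows "norm (c *s v) = norm c * norm v"
  by (simp add: norm_vec_def norm_mult L2_set_right_distrib)

lemma contraction_perturbed_tendsto_0:
  fixes a b :: "nat \<Rightarrow> real"
  assumes a: "\<And>k. 0 \<le> a k" and step: "\<And>k. a (Suc k) \<le> r * a k + b k"
    and r: "0 \<le> r" "r < 1" and b: "b \<longlonglongrightarrow> 0"
  shows "a \<longlonglongrightarrow> 0"
proof (rule LIMSEQ_I)
  fix e :: real assume e: "0 < e"
  \<comment> \<open>With this threshold the recursion x = r * x + e * (1 - r) / 2 has fixed point e
    / 2, which is the constant term of \<open>bound\<close>.\<close>
  then have "0 < e * (1 - r) / 2" using r by simp
  from LIMSEQ_D[OF b this] obtain N where N: "\<And>k. k \<ge> N \<Longrightarrow> \<bar>b k\<bar> < e * (1 - r) / 2"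
    by auto
  have bound: "a (N + k) \<le> r ^ k * a N + e / 2" for k
  proof (induction k)
    case 0
    show ?case using e by simp
  next
    case (Suc k)
    have "a (N + Suc k) \<le> r * a (N + k) + e * (1 - r) / 2"
      using step[of "N + k"] N[of "N + k"] by simp
    also have "\<dots> \<le> r * (r ^ k * a N + e / 2) + e * (1 - r) / 2"
      using Suc r by (simp add: mult_left_mono)
    also have "\<dots> = r ^ Suc k * a N + e / 2" by (simp add: field_simps)
    finally show ?case .
  qed
  have "(\<lambda>k. r ^ k * a N) \<longlonglongrightarrow> 0"
    using r by (intro tendsto_mult_left_zero LIMSEQ_power_zero) simp
  then obtain n where n: "\<And>k. k \<ge> n \<Longrightarrow> \<bar>r ^ k * a N\<bar> < e / 2"
    using e LIMSEQ_D[of _ 0 "e / 2"] by fastforce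
  have "norm (a k - 0) < e" if "k \<ge> N + n" for k
  proof -
    have "\<bar>r ^ (k - N) * a N\<bar> < e / 2"
      using that by (intro n) simp
    then show ?thesis using bound[of "k - N"] that a[of k] by (simp add: abs_le_iff)
  qed
  then show "\<exists>no. \<forall>k\<ge>no. norm (a k - 0) < e" by blast
qed

lemma tendsto_matrix_vector_mult:
  fixes M :: "'a::real_normed_field^'n^'m"
  assumes "(f \<longlongrightarrow> l) F"
  shows "((\<lambda>x. M *v f x) \<longlongrightarrow> M *v l) F"
  unfolding matrix_vector_mult_def
  by (intro tendsto_vec_lambda tendsto_sum tendsto_mult tendsto_const tendsto_vec_nth assms)

lemma funpow_matrix_vector_mult_diff:
  fixes M :: "'a::field^'n^'n"
  shows "((*v) M ^^ k) (v - w) = ((*v) M ^^ k) v - ((*v) M ^^ k) w"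
  by (induction k) (simp_all add: matrix_vector_mult_diff_distrib)

lemma funpow_matrix_vector_mult_scale:
  fixes M :: "'a::field^'n^'n"
  shows "((*v) M ^^ k) (c *s v) = c *s ((*v) M ^^ k) v"
  by (induction k) (simp_all add: vec.scale)

text \<open>M^(k+1) v = c M^k v + M^k (M v - c v), so the norms of M^k v obey a geometric recursion
  of ratio \<open>norm c\<close> with vanishing perturbation.\<close>

lemma powers_tendsto_0_cancel_stable_factor:
  fixes M :: "complex^'n^'n"
  assumes c: "norm c < 1" and lim: "(\<lambda>k. ((*v) M ^^ k) (M *v v - c *s v)) \<longlonglongrightarrow> 0"
  shows "(\<lambda>k. ((*v) M ^^ k) v) \<longlonglongrightarrow> 0"
proof -
  let ?b = "\<lambda>k. ((*v) M ^^ k) (M *v v - c *s v)"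
  have "norm (((*v) M ^^ Suc k) v) \<le> norm c * norm (((*v) M ^^ k) v) + norm (?b k)" for k
  proof -
    have "((*v) M ^^ Suc k) v = c *s ((*v) M ^^ k) v + ?b k"
      by (simp add: funpow_matrix_vector_mult_diff funpow_matrix_vector_mult_scale
          funpow_swap1[of "(*v) M"])
    then show ?thesis
      using norm_triangle_ineq by (metis norm_vector_scalar_mult)
  qed
  then have "(\<lambda>k. norm (((*v) M ^^ k) v)) \<longlonglongrightarrow> 0"
    by (rule contraction_perturbed_tendsto_0[rotated])
       (use c tendsto_norm_zero[OF lim] in auto)
  then show ?thesis by (rule tendsto_norm_zero_cancel)
qed

text \<open>M - c commutes with the powers of M and has a left inverse N, so M^k v = N M^k (M v - c
  v).\<close>

lemma powers_tendsto_0_cancel_invertible_factor: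
  fixes M :: "complex^'n^'n"
  assumes c: "c \<notin> eigenvals M" and lim: "(\<lambda>k. ((*v) M ^^ k) (M *v v - c *s v)) \<longlonglongrightarrow> 0"
  shows "(\<lambda>k. ((*v) M ^^ k) v) \<longlonglongrightarrow> 0"
proof -
  let ?D = "M - mat c"
  have mat_c: "mat c *v w = c *s w" for w :: "complex^'n"
    by (simp add: matrix_vector_mult_def mat_def vec_eq_iff if_distrib if_distribR cong: if_cong)
  have D: "?D *v w = M *v w - c *s w" for w
    by (simp add: matrix_vector_mult_diff_rdistrib mat_c)
  have "\<forall>w. ?D *v w = 0 \<longrightarrow> w = 0"
    using c by (auto simp: D eigenvals_def)
  then obtain N where N: "N ** ?D = mat 1"
    using matrix_left_invertible_ker by blast
  have "((*v) M ^^ k) (M *v v - c *s v) = ?D *v ((*v) M ^^ k) v" for k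
    by (simp add: D funpow_matrix_vector_mult_diff funpow_matrix_vector_mult_scale
          funpow_swap1[of "(*v) M"])
  then have "N *v ((*v) M ^^ k) (M *v v - c *s v) = ((*v) M ^^ k) v" for k
    by (simp add: matrix_vector_mul_assoc N)
  with tendsto_matrix_vector_mult[OF lim, of N] show ?thesis by simp
qed

text \<open>Cancellation with \<open>P\<close> the convergence itself, starting from the annihilated
  vector, whose orbit is constantly 0.\<close>

lemma powers_tendsto_0_complex:
  fixes M :: "complex^'n^'n"
  assumes "\<And>c. c \<in> eigenvals M \<Longrightarrow> norm c < 1"
  shows "(\<lambda>k. ((*v) M ^^ k) v) \<longlonglongrightarrow> 0"
proof -
  obtain p where p: "p \<noteq> 0" "matrix_poly M p v = 0"
    using ex_annihilating_poly_vec by blast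
  show ?thesis
  proof (rule matrix_poly_cancel[where P = "\<lambda>v. (\<lambda>k. ((*v) M ^^ k) v) \<longlonglongrightarrow> 0" and M = M and p = p])
    fix a and w :: "complex^'n"
    assume a: "a \<noteq> 0" and lim: "(\<lambda>k. ((*v) M ^^ k) (a *s w)) \<longlonglongrightarrow> 0"
    have "(\<lambda>k. norm a * norm (((*v) M ^^ k) w)) \<longlonglongrightarrow> 0"
      using tendsto_norm_zero[OF lim]
      by (simp add: funpow_matrix_vector_mult_scale norm_vector_scalar_mult)
    then show "(\<lambda>k. ((*v) M ^^ k) w) \<longlonglongrightarrow> 0"
      using a by (simp add: tendsto_mult_left_iff tendsto_norm_zero_iff)
  next
    fix c and w :: "complex^'n"
    assume "(\<lambda>k. ((*v) M ^^ k) (M *v w - c *s w)) \<longlonglongrightarrow> 0"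
    then show "(\<lambda>k. ((*v) M ^^ k) w) \<longlonglongrightarrow> 0"
      using assms powers_tendsto_0_cancel_stable_factor
        powers_tendsto_0_cancel_invertible_factor by metis
  next
    have "((*v) M ^^ k) 0 = 0" for k by (induction k) simp_all
    then show "(\<lambda>k. ((*v) M ^^ k) (matrix_poly M p v)) \<longlonglongrightarrow> 0" by (simp add: p)
  qed (rule p)
qed

text \<open>On a real vector the powers of the complexified matrix agree with the real ones; real
  parts give the limit.\<close>

lemma powers_tendsto_0:
  fixes M :: "real^'n^'n"
  assumes "spectral_rad M < 1"
  shows "(\<lambda>k. ((*v) M ^^ k) v) \<longlonglongrightarrow> 0"
proof -
  let ?C = "map_matrix complex_of_real M"
  let ?w = "(\<chi> i. complex_of_real (v $ i)) :: complex^'n"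
  have "((*v) ?C ^^ k) ?w = (\<chi> i. complex_of_real (((*v) M ^^ k) v $ i))" for k
    by (induction k) (simp_all add: matrix_vector_mult_def map_matrix_def vec_eq_iff)
  then have "(\<lambda>k. (\<chi> i. complex_of_real (((*v) M ^^ k) v $ i)) :: complex^'n) \<longlonglongrightarrow> 0"
    using powers_tendsto_0_complex[of ?C ?w] assms by (simp add: spectral_rad_less_iff)
  from tendsto_Re[OF tendsto_vec_nth[OF this]] show ?thesis
    by (intro vec_tendstoI) simp
qed

section \<open>The discrete Lyapunov (Stein) equation\<close>

lemma matrix_mult_scaleR_right: "M ** (c *\<^sub>R N) = c *\<^sub>R (M ** N)"
  for M :: "real^'n^'m" and N :: "real^'k^'n"
  by (simp add: matrix_matrix_mult_def vec_eq_iff sum_distrib_left mult_ac)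

lemma inner_transpose_matrix_vector:
  fixes M :: "real^'n^'m"
  shows "x \<bullet> (transpose M *v y) = (M *v x) \<bullet> y"
  by (metis dot_lmul_matrix inner_commute transpose_matrix_vector)

lemma symmetric_matrix_inner:
  assumes "symmetric_matrix M"
  shows "x \<bullet> (M *v y) = (M *v x) \<bullet> y"
  using assms inner_transpose_matrix_vector[of x M y] by (simp add: symmetric_matrix_def del: transpose_matrix_vector)

text \<open>Moving \<open>transpose M\<close> to the other argument turns the matrix equation into a
  one-step recursion along orbits of M, which can be iterated.\<close>

lemma stein_form:
  fixes M X Z :: "real^'n^'n"
  assumes "X = transpose M ** X ** M + Z"
  shows "x \<bullet> (X *v y) = (M *v x) \<bullet> (X *v (M *v y)) + x \<bullet> (Z *v y)"
  by (subst assms)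
     (simp add: matrix_vector_mult_add_rdistrib inner_add_right inner_transpose_matrix_vector
       del: transpose_matrix_vector flip: matrix_vector_mul_assoc)

lemma stein_form_tendsto_0:
  fixes M X :: "real^'n^'n"
  assumes "spectral_rad M < 1"
  shows "(\<lambda>k. (((*v) M ^^ k) x) \<bullet> (X *v (((*v) M ^^ k) y))) \<longlonglongrightarrow> 0"
  using tendsto_inner[OF powers_tendsto_0[OF assms, of x]
      tendsto_matrix_vector_mult[OF powers_tendsto_0[OF assms, of y], of X]] by simp

text \<open>The bilinear form of X is constant along the pair of orbits of x and y, and it tends to
  0 there.\<close>

lemma stein_homogeneous_unique:
  fixes M X :: "real^'n^'n"
  assumes "spectral_rad M < 1" and X: "X = transpose M ** X ** M"
  shows "X = 0"
proof -
  have step: "x \<bullet> (X *v y) = (M *v x) \<bullet> (X *v (M *v y))" for x y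
    using stein_form[of X M 0 x y] X by simp
  have "x \<bullet> (X *v y) = (((*v) M ^^ k) x) \<bullet> (X *v (((*v) M ^^ k) y))" for x y k
    by (induction k) (simp_all flip: step)
  then have "x \<bullet> (X *v y) = 0" for x y
    using stein_form_tendsto_0[OF assms(1), of x X y] by (simp add: LIMSEQ_const_iff)
  then have "X *v y = 0 *v y" for y
    by (metis inner_eq_zero_iff matrix_vector_mult_0)
  then show ?thesis by (simp add: matrix_eq)
qed

text \<open>The linear map X - M^T X M is injective by the homogeneous case, hence bijective in
  finite dimension.\<close>

lemma ex1_stein:
  fixes M Z :: "real^'n^'n"
  assumes "spectral_rad M < 1"
  shows "\<exists>!X. X = transpose M ** X ** M + Z"
proof -
  define F where "F X = X - transpose M ** X ** M" for X :: "real^'n^'n"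
  have "linear F"
    by (rule linearI)
       (simp_all add: F_def vec_eq_iff matrix_matrix_mult_def sum.distrib sum_distrib_left algebra_simps)
  moreover have "inj F"
    using stein_homogeneous_unique[OF assms]
    by (auto simp: linear_injective_0[OF \<open>linear F\<close>] F_def)
  ultimately have "bij F"
    using linear_inj_imp_surj by (auto simp: bij_def)
  then have "\<exists>!X. F X = Z" by (simp add: bij_iff)
  then show ?thesis by (simp add: F_def diff_eq_eq add.commute)
qed

lemma lyapunov_sol_transpose:
  fixes M Z :: "real^'n^'n"
  assumes "spectral_rad M < 1"
  shows "lyapunov_sol (transpose M) Z = transpose M ** lyapunov_sol (transpose M) Z ** M + Z"
  using theI'[OF ex1_stein[OF assms, of Z]] by (simp add: lyapunov_sol_def)

text \<open>The transpose of the solution solves the same equation, so uniqueness applies.\<close>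

lemma symmetric_lyapunov_sol:
  fixes M Z :: "real^'n^'n"
  assumes "spectral_rad M < 1" and Z: "symmetric_matrix Z"
  shows "symmetric_matrix (lyapunov_sol (transpose M) Z)"
proof -
  let ?X = "lyapunov_sol (transpose M) Z"
  note X = lyapunov_sol_transpose[OF assms(1), of Z]
  have "transpose ?X = transpose (transpose M ** ?X ** M + Z)"
    using X by simp
  also have "\<dots> = transpose M ** transpose ?X ** M + Z"
  proof -
    have "transpose (U + V) = transpose U + transpose V" for U V :: "real^'n^'n"
      by (simp add: transpose_def vec_eq_iff)
    then show ?thesis
      using Z by (simp add: matrix_transpose_mul symmetric_matrix_def matrix_mul_assoc)
  qed
  finally show ?thesis
    using X ex1_stein[OF assms(1), of Z] unfolding symmetric_matrix_def by blast
qed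

lemma stein_form_ge:
  fixes M X Z :: "real^'n^'n"
  assumes "spectral_rad M < 1" and X: "X = transpose M ** X ** M + Z"
    and Z: "\<And>v. 0 \<le> v \<bullet> (Z *v v)"
  shows "x \<bullet> (Z *v x) \<le> x \<bullet> (X *v x)"
proof -
  note step = stein_form[OF X]
  \<comment> \<open>Telescoping, with only the first Z-term kept and the later nonnegative ones
    dropped; \<open>Suc k\<close> makes that term present already at k = 0.\<close>
  have "(((*v) M ^^ Suc k) x) \<bullet> (X *v (((*v) M ^^ Suc k) x)) + x \<bullet> (Z *v x) \<le> x \<bullet> (X *v x)" for k
  proof (induction k)
    case 0
    show ?case using step[of x x] by simp
  next
    case (Suc k)
    then show ?case
      using step[of "((*v) M ^^ Suc k) x" "((*v) M ^^ Suc k) x"] Z[of "((*v) M ^^ Suc k) x"] by simp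
  qed
  moreover have "(\<lambda>k. (((*v) M ^^ Suc k) x) \<bullet> (X *v (((*v) M ^^ Suc k) x)) + x \<bullet> (Z *v x))
      \<longlonglongrightarrow> 0 + x \<bullet> (Z *v x)"
    by (intro tendsto_intros LIMSEQ_Suc stein_form_tendsto_0 assms)
  ultimately show ?thesis
    using LIMSEQ_le_const2 by fastforce
qed

section \<open>Quadratic forms and extreme eigenvalues of symmetric matrices\<close>

text \<open>If N u were nonzero, a small move from u along - N u would make the form negative to
  first order.\<close>

lemma psd_form_eq_0_imp_kernel:
  fixes N :: "real^'n^'n"
  assumes sym: "symmetric_matrix N" and psd: "\<And>v. 0 \<le> v \<bullet> (N *v v)" and u: "u \<bullet> (N *v u) = 0"
  shows "N *v u = 0"
proof (rule ccontr)
  let ?w = "N *v u"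
  assume "?w \<noteq> 0"
  then have pos: "0 < ?w \<bullet> ?w" by simp
  let ?c = "?w \<bullet> (N *v ?w)"
  \<comment> \<open>Small enough that t * ?c stays below \<open>?w \<bullet> ?w\<close>; the + 1
    covers ?c = 0.\<close>
  define t where "t = ?w \<bullet> ?w / (?c + 1)"
  have c: "0 \<le> ?c" by (rule psd)
  have "0 \<le> (u - t *\<^sub>R ?w) \<bullet> (N *v (u - t *\<^sub>R ?w))" by (rule psd)
  also have "\<dots> = t * (t * ?c - 2 * (?w \<bullet> ?w))"
    using u symmetric_matrix_inner[OF sym, of u ?w]
    by (simp add: matrix_vector_mult_diff_distrib matrix_vector_mult_scaleR inner_diff_left
        inner_diff_right algebra_simps power2_eq_square)
  finally have "2 * (?w \<bullet> ?w) \<le> t * ?c"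
    using pos c by (simp add: t_def zero_le_mult_iff divide_le_0_iff zero_le_divide_iff)
  also have "t * ?c \<le> ?w \<bullet> ?w"
    using pos c by (simp add: t_def field_simps)
  finally show False using pos by simp
qed

text \<open>The maximum c of the form on the unit sphere is attained at some u. Then c - M is
  positive semidefinite with zero form at u, so u is an eigenvector.\<close>

lemma symmetric_matrix_ex_dominant_eigenval:
  fixes M :: "real^'n^'n"
  assumes sym: "symmetric_matrix M"
  shows "\<exists>c\<in>eigenvals M. \<forall>v. v \<bullet> (M *v v) \<le> c * (norm v)\<^sup>2"
proof -
  have "continuous_on (sphere 0 1) (\<lambda>v. v \<bullet> (M *v v))"
    by (intro continuous_intros linear_continuous_on matrix_vector_mul_bounded_linear)
  moreover have "sphere (0 :: real^'n) 1 \<noteq> {}" by simp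
  ultimately obtain u where u: "norm u = 1"
    and max: "\<And>v. norm v = 1 \<Longrightarrow> v \<bullet> (M *v v) \<le> u \<bullet> (M *v u)"
    using continuous_attains_sup[OF compact_sphere[of 0 1]] by (force simp: sphere_def dist_norm)
  define c where "c = u \<bullet> (M *v u)"
  define N where "N = c *\<^sub>R mat 1 - M"
  have N: "N *v v = c *\<^sub>R v - M *v v" for v
    by (simp add: N_def matrix_vector_mult_diff_rdistrib flip: scaleR_matrix_vector_assoc)
  have le: "v \<bullet> (M *v v) \<le> c * (norm v)\<^sup>2" for v
  proof (cases "v = 0")
    case False
    have "(v /\<^sub>R norm v) \<bullet> (M *v (v /\<^sub>R norm v)) \<le> c"
      unfolding c_def using False by (intro max) simp
    then show ?thesis
      using False by (simp add: matrix_vector_mult_scaleR power2_eq_square field_simps)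
  qed simp
  have "symmetric_matrix N"
    using sym by (simp add: symmetric_matrix_def N_def transpose_def vec_eq_iff mat_def)
  moreover have "0 \<le> v \<bullet> (N *v v)" for v
    using le by (simp add: N inner_diff_right power2_norm_eq_inner)
  moreover have "u \<bullet> (N *v u) = 0"
    using u by (simp add: N inner_diff_right c_def flip: power2_norm_eq_inner)
  ultimately have "N *v u = 0" by (rule psd_form_eq_0_imp_kernel)
  then have "M *v u = c *s u" by (simp add: N scalar_mult_eq_scaleR)
  moreover have "u \<noteq> 0" using u by auto
  ultimately have "c \<in> eigenvals M" by (auto simp: eigenvals_def)
  then show ?thesis using le by blast
qed

lemma eigenvals_uminus: "c \<in> eigenvals (- M) \<longleftrightarrow> - c \<in> eigenvals M"
proof -
  have "(- M) *v v = c *s v \<longleftrightarrow> M *v v = (- c) *s v" for v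
    using matrix_vector_mult_diff_rdistrib[of 0 M v] by (auto simp: minus_equation_iff[of "M *v v"])
  then show ?thesis by (simp add: eigenvals_def)
qed

lemma form_le_max_eigenval:
  assumes "symmetric_matrix M"
  shows "v \<bullet> (M *v v) \<le> max_eigenval M * (norm v)\<^sup>2"
proof -
  obtain c where c: "c \<in> eigenvals M" "v \<bullet> (M *v v) \<le> c * (norm v)\<^sup>2"
    using symmetric_matrix_ex_dominant_eigenval[OF assms] by blast
  then have "c \<le> max_eigenval M" by (simp add: max_eigenval_def finite_eigenvals)
  then have "c * (norm v)\<^sup>2 \<le> max_eigenval M * (norm v)\<^sup>2" by (simp add: mult_right_mono)
  with c show ?thesis by simp
qed

text \<open>The upper bound on the form of \<open>- M\<close>, with signs reversed.\<close>

lemma min_eigenval_le_form: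
  assumes "symmetric_matrix M"
  shows "min_eigenval M * (norm v)\<^sup>2 \<le> v \<bullet> (M *v v)"
proof -
  have "symmetric_matrix (- M)"
    using assms by (simp add: symmetric_matrix_def transpose_def vec_eq_iff)
  then obtain c where c: "- c \<in> eigenvals M" "v \<bullet> ((- M) *v v) \<le> c * (norm v)\<^sup>2"
    using symmetric_matrix_ex_dominant_eigenval eigenvals_uminus by metis
  then have "min_eigenval M \<le> - c" by (simp add: min_eigenval_def finite_eigenvals)
  then have "min_eigenval M * (norm v)\<^sup>2 \<le> - c * (norm v)\<^sup>2" by (rule mult_right_mono) simp
  moreover have "v \<bullet> ((- M) *v v) = - (v \<bullet> (M *v v))"
    using matrix_vector_mult_diff_rdistrib[of 0 M v] by simp
  ultimately show ?thesis using c by simp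
qed

lemma min_eigenval_pos:
  assumes "symmetric_matrix M" "positive_definite M"
  shows "0 < min_eigenval M"
proof -
  have "eigenvals M \<noteq> {}" using symmetric_matrix_ex_dominant_eigenval[OF assms(1)] by blast
  then have "min_eigenval M \<in> eigenvals M" by (simp add: min_eigenval_def finite_eigenvals)
  then obtain v where "v \<noteq> 0" "M *v v = min_eigenval M *s v" by (auto simp: eigenvals_def)
  moreover from this have "v \<bullet> (M *v v) = min_eigenval M * (v \<bullet> v)"
    by (simp add: scalar_mult_eq_scaleR)
  ultimately show ?thesis
    using assms(2) by (metis inner_gt_zero_iff positive_definite_def zero_less_mult_pos2)
qed

section \<open>Contraction in the norm of a quadratic form\<close>

text \<open>The form is evaluated at c u - b v. As it is only semidefinite, c = 0 is possible for
  nonzero v; then v lies in the kernel.\<close>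

lemma psd_form_Cauchy_Schwarz:
  fixes X :: "real^'n^'n"
  assumes sym: "symmetric_matrix X" and psd: "\<And>v. 0 \<le> v \<bullet> (X *v v)"
  shows "u \<bullet> (X *v v) \<le> sqrt (u \<bullet> (X *v u)) * sqrt (v \<bullet> (X *v v))"
proof -
  define a b c where abc: "a = u \<bullet> (X *v u)" "b = u \<bullet> (X *v v)" "c = v \<bullet> (X *v v)"
  have form: "(s *\<^sub>R u - t *\<^sub>R v) \<bullet> (X *v (s *\<^sub>R u - t *\<^sub>R v)) = s\<^sup>2 * a - 2 * s * t * b + t\<^sup>2 * c" for s t
    using symmetric_matrix_inner[OF sym, of v u]
    by (simp add: abc matrix_vector_mult_diff_distrib matrix_vector_mult_scaleR inner_diff_left
        inner_diff_right algebra_simps power2_eq_square inner_commute)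
  have nn: "0 \<le> s\<^sup>2 * a - 2 * s * t * b + t\<^sup>2 * c" for s t
    using psd[of "s *\<^sub>R u - t *\<^sub>R v"] by (simp add: form)
  have "b\<^sup>2 \<le> a * c"
  proof (cases "c = 0")
    case True
    then have "X *v v = 0" using psd_form_eq_0_imp_kernel[OF sym psd] by (simp add: abc)
    then show ?thesis by (simp add: abc)
  next
    case False
    have "0 \<le> c * (a * c - b\<^sup>2)"
      using nn[of c b] by (simp add: power2_eq_square algebra_simps)
    moreover have "0 < c" using False psd[of v] by (simp add: abc)
    ultimately show ?thesis by (simp add: zero_le_mult_iff)
  qed
  then have "b \<le> sqrt (a * c)" by (rule real_le_rsqrt)
  then show ?thesis by (simp add: abc real_sqrt_mult)
qed

text \<open>Writing an eigenvector as \<open>x + i y\<close>, the Hermitian extension of the form takes the value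
  \<open>q x + q y\<close> with \<open>q v = v \<bullet> X v\<close>, and applying \<open>M\<close> multiplies it by \<open>\<bar>c\<bar>\<^sup>2\<close>.\<close>

lemma spectral_rad_less_1_if_form_decreasing:
  fixes M X :: "real^'n^'n"
  assumes sym: "symmetric_matrix X" and pos: "\<And>v. v \<noteq> 0 \<Longrightarrow> 0 < v \<bullet> (X *v v)"
    and dec: "\<And>v. v \<noteq> 0 \<Longrightarrow> (M *v v) \<bullet> (X *v (M *v v)) < v \<bullet> (X *v v)"
  shows "spectral_rad M < 1"
  unfolding spectral_rad_less_iff
proof
  fix c assume "c \<in> eigenvals (map_matrix complex_of_real M)"
  then obtain w where w: "w \<noteq> 0" "map_matrix complex_of_real M *v w = c *s w"
    by (auto simp: eigenvals_def)
  define q where "q v = v \<bullet> (X *v v)" for v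
  define x y where xy: "x = (\<chi> i. Re (w $ i))" "y = (\<chi> i. Im (w $ i))"
  have "(\<Sum>j\<in>UNIV. complex_of_real (M $ i $ j) * w $ j) = c * w $ i" for i
    using w(2) by (simp add: vec_eq_iff matrix_vector_mult_def map_matrix_def)
  then have Mxy: "M *v x = Re c *\<^sub>R x - Im c *\<^sub>R y" "M *v y = Re c *\<^sub>R y + Im c *\<^sub>R x"
    by (simp_all add: xy matrix_vector_mult_def vec_eq_iff complex_eq_iff)
  \<comment> \<open>The mixed terms in x and y have opposite signs in the two summands and
    cancel.\<close>
  have eq: "q (M *v x) + q (M *v y) = (norm c)\<^sup>2 * (q x + q y)"
    using symmetric_matrix_inner[OF sym, of x y]
    by (simp add: q_def Mxy cmod_power2)
       (simp add: matrix_vector_mult_diff_distrib matrix_vector_right_distrib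
        matrix_vector_mult_scaleR inner_diff_left inner_diff_right inner_add_left inner_add_right
        algebra_simps power2_eq_square inner_commute)
  have "x \<noteq> 0 \<or> y \<noteq> 0"
    using w(1) by (auto simp: xy vec_eq_iff complex_eq_iff)
  \<comment> \<open>One of x and y may vanish; the weak inequalities cover it, and the other part
    supplies strictness.\<close>
  moreover have "q v \<ge> 0" "q (M *v v) \<le> q v" for v
    using pos[of v] dec[of v] by (cases "v = 0"; simp add: q_def)+
  ultimately have "q (M *v x) + q (M *v y) < q x + q y" "0 < q x + q y"
    using pos dec by (metis q_def add_less_le_mono add_le_less_mono,
        metis q_def add_pos_nonneg add_nonneg_pos)
  then have "(norm c)\<^sup>2 < 1\<^sup>2" unfolding eq by (simp add: mult_less_cancel_right1)
  then show "norm c < 1" by (simp add: power_less_imp_less_base)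
qed

text \<open>In the norm \<open>sqrt (v \<bullet> X v)\<close>, \<open>M\<close> maps a unit vector \<open>v\<close> of length \<open>p\<close> to one of length at
  most \<open>sqrt (p\<^sup>2 - l) < p - l / (2 * p)\<close>, while \<open>D\<close> adds at most \<open>l / (2 * sqrt L) \<le> l / (2 * p)\<close>.\<close>

lemma form_decreasing_perturbed:
  fixes M X Z D :: "real^'n^'n"
  assumes sym: "symmetric_matrix X" and X: "X = transpose M ** X ** M + Z"
    and lower: "\<And>v. l * (norm v)\<^sup>2 \<le> v \<bullet> (Z *v v)" and "0 < l"
    and dom: "\<And>v. v \<bullet> (Z *v v) \<le> v \<bullet> (X *v v)"
    and upper: "\<And>v. v \<bullet> (X *v v) \<le> L * (norm v)\<^sup>2"
    and D: "\<And>v. 2 * L * norm (D *v v) \<le> l * norm v" and v: "v \<noteq> 0"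
  shows "((M + D) *v v) \<bullet> (X *v ((M + D) *v v)) < v \<bullet> (X *v v)"
proof -
  define q where "q u = u \<bullet> (X *v u)" for u
  let ?n = "norm v" and ?p = "sqrt (q v)"
  have n: "0 < ?n" using v by simp
  have q_ge: "l * (norm u)\<^sup>2 \<le> q u" for u
    using order_trans[OF lower dom] by (simp add: q_def)
  have psd: "0 \<le> u \<bullet> (X *v u)" for u
    using q_ge[of u] \<open>0 < l\<close> unfolding q_def by (meson order_trans mult_nonneg_nonneg less_imp_le zero_le_power2)
  have ln: "0 < l * ?n\<^sup>2" using n \<open>0 < l\<close> by simp
  then have qv: "0 < q v" using q_ge[of v] by linarith
  have "0 < L * ?n\<^sup>2" using qv upper[of v] by (simp add: q_def)
  then have L: "0 < L" using n by (simp add: zero_less_mult_iff)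
  \<comment> \<open>Chosen so that 2 * ?p * t = l * ?n^2: the first-order loss of length under
    M.\<close>
  define t where "t = l * ?n\<^sup>2 / (2 * ?p)"
  have p: "0 < ?p" "?p\<^sup>2 = q v" using qv by simp_all
  have t: "0 < t" using ln p by (simp add: t_def)
  \<comment> \<open>Keeps ?p - t nonnegative, as required when roots are taken below.\<close>
  have "t \<le> ?p"
    using q_ge[of v] p ln by (simp add: t_def divide_le_eq mult.left_commute[of _ 2] flip: power2_eq_square)
  have "sqrt (q (M *v v)) < ?p - t"
  proof -
    have "q (M *v v) \<le> q v - l * ?n\<^sup>2"
      using stein_form[OF X, of v v] lower[of v] by (simp add: q_def)
    \<comment> \<open>The gap is exactly t^2. This strictness lets the bound on D be
      attained.\<close>
    also have "\<dots> < (?p - t)\<^sup>2"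
    proof -
      have "2 * ?p * t = l * ?n\<^sup>2" using p by (simp add: t_def)
      then show ?thesis using t p by (simp add: power2_diff)
    qed
    finally show ?thesis using \<open>t \<le> ?p\<close> by (simp add: real_less_lsqrt real_sqrt_less_iff)
  qed
  moreover have "sqrt (q (D *v v)) \<le> t"
  proof -
    have "sqrt (q (D *v v)) \<le> sqrt L * norm (D *v v)"
      using upper[of "D *v v"] real_sqrt_le_mono by (fastforce simp: q_def real_sqrt_mult)
    also have "\<dots> \<le> l * ?n / (2 * sqrt L)"
    proof -
      have "sqrt L * norm (D *v v) * (2 * sqrt L) = 2 * L * norm (D *v v)"
        using L by simp
      then have "sqrt L * norm (D *v v) * (2 * sqrt L) \<le> l * ?n"
        using D[of v] by (rule ord_eq_le_trans)
      then show ?thesis using L by (subst pos_le_divide_eq) simp_all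
    qed
    \<comment> \<open>Expanded by ?n, the fraction differs from t only in its denominator.\<close>
    also have "\<dots> = l * ?n\<^sup>2 / (2 * (sqrt L * ?n))"
      using n by (simp add: power2_eq_square)
    also have "\<dots> \<le> t"
    proof -
      have "?p \<le> sqrt L * ?n"
        using upper[of v] real_sqrt_le_mono by (fastforce simp: q_def real_sqrt_mult)
      then show ?thesis unfolding t_def using p ln L n
        by (intro divide_left_mono mult_left_mono mult_pos_pos) simp_all
    qed
    finally show ?thesis .
  qed
  ultimately have sum: "sqrt (q (M *v v)) + sqrt (q (D *v v)) < ?p" by simp
  have "q (M *v v + D *v v) = q (M *v v) + 2 * ((M *v v) \<bullet> (X *v (D *v v))) + q (D *v v)"
    using symmetric_matrix_inner[OF sym, of "D *v v" "M *v v"]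
    by (simp add: q_def matrix_vector_right_distrib inner_add_left inner_add_right inner_commute)
  \<comment> \<open>The triangle inequality for the norm \<open>sqrt (q u)\<close>.\<close>
  also have "\<dots> \<le> (sqrt (q (M *v v)) + sqrt (q (D *v v)))\<^sup>2"
    using psd_form_Cauchy_Schwarz[OF sym psd, of "M *v v" "D *v v"] psd
    by (simp add: q_def power2_sum)
  also have "\<dots> < ?p\<^sup>2"
    using sum psd by (intro power_strict_mono) (auto simp: q_def)
  finally show ?thesis using p by (simp add: q_def matrix_vector_mult_add_rdistrib)
qed

theorem mainTheorem3:
  fixes A :: "real^'n^'n" and B :: "real^'m^'n"
    and Q :: "real^'n^'m \<Rightarrow> real^'n^'n"
    and K G :: "real^'n^'m" and \<eta> :: real
  assumes "stabilizable A B"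
    and "smooth_map_on (stabilizing_gains A B) Q"
    and "\<And>L. L \<in> stabilizing_gains A B \<Longrightarrow> symmetric_matrix (Q L) \<and> positive_definite (Q L)"
    and "K \<in> stabilizing_gains A B"
    and "0 \<le> \<eta>" and "ereal \<eta> \<le> stability_certificate A B Q K G"
  shows "K + \<eta> *\<^sub>R G \<in> stabilizing_gains A B"
proof -
  let ?M = "A + B ** K" and ?D = "\<eta> *\<^sub>R (B ** G)"
  have M: "spectral_rad ?M < 1"
    using assms(4) by (simp add: stabilizing_gains_def)
  have closed_loop: "A + B ** (K + \<eta> *\<^sub>R G) = ?M + ?D"
    by (simp add: matrix_add_ldistrib matrix_mult_scaleR_right add.assoc)
  have "spectral_rad (?M + ?D) < 1"
  proof (cases "B ** G = 0")
    case True
    \<comment> \<open>The certificate is infinite here, and the closed loop does not change.\<close>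
    then show ?thesis using M by simp
  next
    case False
    let ?X = "lyapunov_sol (transpose ?M) (Q K)"
    let ?l = "min_eigenval (Q K)" and ?L = "max_eigenval ?X" and ?s = "spectral_norm (B ** G)"
    have Q: "symmetric_matrix (Q K)" "positive_definite (Q K)" using assms(3,4) by blast+
    note X = lyapunov_sol_transpose[OF M, of "Q K"]
    note sym = symmetric_lyapunov_sol[OF M Q(1)]
    have "0 \<le> v \<bullet> (Q K *v v)" for v
      using Q(2) by (cases "v = 0") (auto simp: positive_definite_def less_imp_le)
    then have dom: "v \<bullet> (Q K *v v) \<le> v \<bullet> (?X *v v)" for v
      by (rule stein_form_ge[OF M X])
    have l: "0 < ?l" by (rule min_eigenval_pos[OF Q])
    have pos: "0 < v \<bullet> (?X *v v)" if "v \<noteq> 0" for v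
      using Q(2) dom[of v] that by (force simp: positive_definite_def)
    \<comment> \<open>Any nonzero vector gives this; \<open>1\<close> is the all-ones
      vector.\<close>
    have L: "0 < ?L"
      using pos[of 1] form_le_max_eigenval[OF sym, of 1]
      by (simp add: zero_less_mult_iff) (smt (verit) mult_nonpos_nonneg zero_le_power2)
    have s: "0 < ?s"
      using False matrix_eq[of "B ** G" 0] by (simp add: spectral_norm_def onorm_pos_lt)
    have "\<eta> \<le> ?l / (2 * ?L * ?s)"
      using assms(6) False by (simp add: stability_certificate_def)
    \<comment> \<open>Denominators cleared: the operator-norm form of the bound on the
      perturbation.\<close>
    then have eta: "2 * ?L * (\<eta> * ?s) \<le> ?l"
      using L s by (simp add: pos_le_divide_eq mult_ac)
    have D: "2 * ?L * norm (?D *v v) \<le> ?l * norm v" for v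
    proof -
      have "norm ((B ** G) *v v) \<le> ?s * norm v"
        unfolding spectral_norm_def by (rule onorm) (rule matrix_vector_mul_bounded_linear)
      then have "norm (?D *v v) \<le> \<eta> * (?s * norm v)"
        using assms(5) by (simp add: mult_left_mono flip: scaleR_matrix_vector_assoc)
      then have "2 * ?L * norm (?D *v v) \<le> 2 * ?L * (\<eta> * (?s * norm v))"
        using L by (intro mult_left_mono) simp_all
      also have "\<dots> = 2 * ?L * (\<eta> * ?s) * norm v" by simp
      also have "\<dots> \<le> ?l * norm v" by (rule mult_right_mono[OF eta]) simp
      finally show ?thesis .
    qed
    show ?thesis
      using sym pos
    proof (rule spectral_rad_less_1_if_form_decreasing)
      fix v :: "real^'n"
      assume "v \<noteq> 0"
      then show "((?M + ?D) *v v) \<bullet> (?X *v ((?M + ?D) *v v)) < v \<bullet> (?X *v v)"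
        by (rule form_decreasing_perturbed[where Z = "Q K" and l = ?l and L = ?L and D = ?D,
              OF sym X min_eigenval_le_form[OF Q(1)] l dom form_le_max_eigenval[OF sym] D])
    qed
  qed
  then show ?thesis by (simp add: stabilizing_gains_def closed_loop)
qed

end
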